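(* Let $G$ be a non-periodic locally nilpotent group. If $G$ is a BCI-group then $G$ is abelian.
   Context: A group $G$ is a BCI-group if there exists a positive integer $n$ such that $|C_G(x):\langle x\rangle|\le n$ for every $x\in G$ such that $\langle x\rangle$ is not normal in $G$. A group is non-periodic if it has an element of infinite order. *)

theory Defs
  imports "HOL-Algebra.Algebra"
begin

definition centralizer :: "('a, 'b) monoid_scheme \<Rightarrow> 'a \<Rightarrow> 'a set" where
  "centralizer G x = {g \<in> carrier G. g \<otimes>\<^bsub>G\<^esub> x = x \<otimes>\<^bsub>G\<^esub> g}"

definition commutator_subgroup :: "('a, 'b) monoid_scheme \<Rightarrow> 'a set \<Rightarrow> 'a set \<Rightarrow> 'a set" where
  "commutator_subgroup G H K =
     generate G (\<Union>h \<in> H. \<Union>k \<in> K. {h \<otimes>\<^bsub>G\<^esub> k \<otimes>\<^bsub>G\<^esub> inv\<^bsub>G\<^esub> h \<otimes>\<^bsub>G\<^esub> inv\<^bsub>G\<^esub> k})"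

text \<open>Indexing starts at 0, so that a group is nilpotent of class at most \<open>c\<close> iff the
  \<open>c\<close>-th term is trivial.\<close>

primrec lower_central_series :: "('a, 'b) monoid_scheme \<Rightarrow> nat \<Rightarrow> 'a set" where
  "lower_central_series G 0 = carrier G"
| "lower_central_series G (Suc i) = commutator_subgroup G (lower_central_series G i) (carrier G)"

definition nilpotent_group :: "('a, 'b) monoid_scheme \<Rightarrow> bool" where
  "nilpotent_group G \<longleftrightarrow> group G \<and> (\<exists>c. lower_central_series G c = {\<one>\<^bsub>G\<^esub>})"

definition locally_nilpotent_group :: "('a, 'b) monoid_scheme \<Rightarrow> bool" where
  "locally_nilpotent_group G \<longleftrightarrow>
     group G \<and> (\<forall>S. finite S \<and> S \<subseteq> carrier G \<longrightarrow> nilpotent_group (subgroup_generated G S))"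

text \<open>The order \<^const>\<open>group.ord\<close> is 0 exactly on the elements of infinite order.\<close>

definition non_periodic_group :: "('a, 'b) monoid_scheme \<Rightarrow> bool" where
  "non_periodic_group G \<longleftrightarrow> group G \<and> (\<exists>x \<in> carrier G. group.ord G x = 0)"

text \<open>The finiteness conjunct is needed because \<^const>\<open>card\<close> is 0 on infinite sets, while
  an infinite index must violate the bound.\<close>

definition BCI_group :: "('a, 'b) monoid_scheme \<Rightarrow> bool" where
  "BCI_group G \<longleftrightarrow> group G \<and>
     (\<exists>n::nat. 0 < n \<and>
       (\<forall>x \<in> carrier G. \<not> generate G {x} \<lhd> G \<longrightarrow>
          finite (rcosets\<^bsub>G\<lparr>carrier := centralizer G x\<rparr>\<^esub> (generate G {x})) \<and>
          card (rcosets\<^bsub>G\<lparr>carrier := centralizer G x\<rparr>\<^esub> (generate G {x})) \<le> n))"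

end

theory Submission
  imports Defs
begin

text \<open>Let \<open>n\<close> bound the indices. If \<open>x\<close> has infinite order and \<open>p > n\<close>, then the centralizer of
  \<open>x\<^sup>p\<close> contains \<open>x\<close>, so \<open>\<langle>x\<^sup>p\<rangle>\<close> has index at least \<open>p\<close> in it and must be normal in \<open>G\<close>. In a
  locally nilpotent group a normal infinite cyclic subgroup is central: if \<open>g y g\<^sup>-\<^sup>1 = y\<^sup>a\<close>, then
  commutating \<open>k\<close> times with \<open>g\<close> gives \<open>y\<close> raised to \<open>(1 - a)\<^sup>k\<close>, whence \<open>a = 1\<close>. Thus
  \<open>x\<^sup>n\<^sup>+\<^sup>1\<close> and \<open>x\<^sup>n\<^sup>+\<^sup>2\<close> are central, and so is \<open>x\<close>. Finally, if \<open>z\<close> has infinite order and \<open>y\<close> has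
  finite order, then \<open>y z\<close> has infinite order because \<open>z\<close> is central, so \<open>y z\<close> and \<open>y\<close> are central.\<close>

lemma (in group) int_pow_conj:
  assumes "g \<in> carrier G" "y \<in> carrier G"
  shows "g \<otimes> y [^] (m::int) \<otimes> inv g = (g \<otimes> y \<otimes> inv g) [^] m"
proof -
  have "(\<lambda>u. g \<otimes> u \<otimes> inv g) \<in> hom G G"
    using assms by (auto intro!: homI simp: m_assoc inv_solve_left)
  then interpret group_hom G G "\<lambda>u. g \<otimes> u \<otimes> inv g"
    by unfold_locales
  show ?thesis
    using assms by (simp add: hom_int_pow)
qed

lemma (in group) int_pow_mem_lower_central_series:
  assumes "g \<in> carrier G" "y \<in> carrier G" and conj: "g \<otimes> y \<otimes> inv g = y [^] (a::int)"
  shows "y [^] ((1 - a) ^ k) \<in> lower_central_series G k"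
proof (induction k)
  case 0
  then show ?case using assms by simp
next
  case (Suc k)
  let ?m = "(1 - a) ^ k"
  \<comment> \<open>Regrouped so that \<open>g\<close> conjugates a power of \<open>y\<close>, which
    \<open>conj\<close> turns into that power raised to \<open>a\<close>.\<close>
  have "y [^] ?m \<otimes> g \<otimes> inv (y [^] ?m) \<otimes> inv g = y [^] ?m \<otimes> (g \<otimes> y [^] (- ?m) \<otimes> inv g)"
    using assms by (simp add: int_pow_neg m_assoc)
  also have "\<dots> = y [^] ?m \<otimes> y [^] (a * - ?m)"
    using assms by (simp add: int_pow_conj int_pow_pow)
  also have "\<dots> = y [^] ((1 - a) ^ Suc k)"
    using assms by (simp add: int_pow_mult[symmetric] algebra_simps)
  finally show ?case
    using Suc.IH assms(1) unfolding lower_central_series.simps commutator_subgroup_def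
    by (intro generate.incl UN_I[of "y [^] ?m"] UN_I[of g]) simp_all
qed

lemma nilpotent_group_conj_int_pow:
  assumes "nilpotent_group G" "g \<in> carrier G" "y \<in> carrier G" "group.ord G y = 0"
    and "g \<otimes>\<^bsub>G\<^esub> y \<otimes>\<^bsub>G\<^esub> inv\<^bsub>G\<^esub> g = y [^]\<^bsub>G\<^esub> (a::int)"
  shows "a = 1"
proof -
  interpret group G
    using assms(1) by (simp add: nilpotent_group_def)
  obtain c where "lower_central_series G c = {\<one>\<^bsub>G\<^esub>}"
    using assms(1) unfolding nilpotent_group_def by blast
  then have "y [^]\<^bsub>G\<^esub> ((1 - a) ^ c) = \<one>\<^bsub>G\<^esub>"
    using int_pow_mem_lower_central_series[OF assms(2,3,5), of c] by simp
  \<comment> \<open>Only exponent 0 kills an element of infinite order. The case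
    \<open>c = 0\<close> would give \<open>1 = 0\<close>: a trivial group has no such
    \<open>y\<close>.\<close>
  then have "(1 - a) ^ c = 0"
    using assms(3,4) by (simp add: int_pow_eq_id)
  then show ?thesis by simp
qed

lemma locally_nilpotent_normal_cyclic_central:
  fixes G (structure)
  assumes "locally_nilpotent_group G" "y \<in> carrier G" "group.ord G y = 0"
    and "generate G {y} \<lhd> G" and "g \<in> carrier G"
  shows "g \<otimes>\<^bsub>G\<^esub> y = y \<otimes>\<^bsub>G\<^esub> g"
proof -
  interpret group G
    using assms(1) by (simp add: locally_nilpotent_group_def)
  \<comment> \<open>The conjugation relation involves only \<open>y\<close> and \<open>g\<close>, so
    it can be read in this finitely generated, hence nilpotent, subgroup.\<close>
  let ?H = "subgroup_generated G {y, g}"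
  have nil: "nilpotent_group ?H"
    using assms unfolding locally_nilpotent_group_def by simp
  have mem: "y \<in> carrier ?H" "g \<in> carrier ?H"
    using assms by (auto simp: carrier_subgroup_generated intro: generate.incl)
  have "y \<in> generate G {y}"
    by (simp add: generate.incl)
  then have "g \<otimes> y \<otimes> inv g \<in> generate G {y}"
    using normal.inv_op_closed2[OF assms(4,5)] by blast
  then obtain a :: int where a: "g \<otimes> y \<otimes> inv g = y [^] a"
    using generate_pow[OF assms(2)] by auto
  interpret H: group ?H
    by simp
  have "H.ord y = 0"
    using assms(3) mem assms(2) H.pow_eq_id pow_eq_id
    by (metis dvd_0_left dvd_refl one_subgroup_generated pow_subgroup_generated)
  then have "a = 1"
    using nilpotent_group_conj_int_pow[OF nil mem(2,1), of a] a mem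
    by (simp add: int_pow_subgroup_generated inv_subgroup_generated)
  then show ?thesis
    using a assms by (metis inv_solve_right int_pow_1 m_closed inv_closed)
qed

text \<open>The cosets of \<open>x [^] i\<close> for \<open>i < p\<close> are distinct: since
  \<open>x\<close> has infinite order, equal cosets force exponents congruent modulo
  \<open>p\<close>.\<close>

lemma (in group) card_rcosets_generate_pow_ge:
  assumes x: "x \<in> carrier G" "ord x = 0"
    and fin: "finite (rcosets\<^bsub>G\<lparr>carrier := centralizer G (x [^] p)\<rparr>\<^esub> (generate G {x [^] p}))"
  shows "p \<le> card (rcosets\<^bsub>G\<lparr>carrier := centralizer G (x [^] (p::nat))\<rparr>\<^esub> (generate G {x [^] p}))"
    (is "_ \<le> card ?R")
proof -
  let ?f = "\<lambda>i::nat. generate G {x [^] p} #> x [^] i"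
  have gen: "generate G {x [^] p} = {x [^] (int p * k) | k. k \<in> UNIV}"
    using x by (simp add: generate_pow int_pow_pow flip: int_pow_int)
  have "inj_on ?f {..<p}"
  proof (rule inj_onI)
    fix i j assume ij: "i \<in> {..<p}" "j \<in> {..<p}" and eq: "?f i = ?f j"
    have "\<one> \<in> generate G {x [^] p}"
      by (rule generate.one)
    then have "x [^] i \<in> ?f i"
      using x unfolding r_coset_def by force
    then have "x [^] i \<in> ?f j"
      by (simp only: eq)
    then obtain k where "x [^] i = x [^] (int p * k) \<otimes> x [^] j"
      unfolding r_coset_def gen by auto
    then have "x [^] int i = x [^] (int p * k + int j)"
      using x by (simp add: int_pow_int int_pow_mult)
    then have "int i = int p * k + int j"
      using x by (simp add: int_pow_eq)
    then have "int i mod int p = int j mod int p"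
      by simp
    then show "i = j"
      using ij by simp
  qed
  \<comment> \<open>Powers of \<open>x\<close> commute with \<open>x [^] p\<close>, so these cosets
    have representatives in the centralizer.\<close>
  moreover have "?f ` {..<p} \<subseteq> ?R"
    using x by (auto simp: RCOSETS_def r_coset_def centralizer_def nat_pow_mult add.commute)
  ultimately show ?thesis
    using card_inj_on_le[OF _ _ fin] by fastforce
qed

lemma infinite_order_central:
  fixes G (structure)
  assumes "locally_nilpotent_group G" "BCI_group G"
    and "x \<in> carrier G" "group.ord G x = 0" "g \<in> carrier G"
  shows "g \<otimes>\<^bsub>G\<^esub> x = x \<otimes>\<^bsub>G\<^esub> g"
proof -
  interpret group G
    using assms(1) by (simp add: locally_nilpotent_group_def)
  obtain n where n: "\<And>x. x \<in> carrier G \<Longrightarrow> \<not> generate G {x} \<lhd> G \<Longrightarrow>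
      finite (rcosets\<^bsub>G\<lparr>carrier := centralizer G x\<rparr>\<^esub> (generate G {x})) \<and>
      card (rcosets\<^bsub>G\<lparr>carrier := centralizer G x\<rparr>\<^esub> (generate G {x})) \<le> n"
    using assms(2) unfolding BCI_group_def by blast
  have pow_central: "g \<otimes> x [^] p = x [^] p \<otimes> g" if "n < p" for p :: nat
  proof (rule locally_nilpotent_normal_cyclic_central)
    show "generate G {x [^] p} \<lhd> G"
    proof (rule ccontr)
      assume "\<not> generate G {x [^] p} \<lhd> G"
      then show False
        using n[of "x [^] p"] card_rcosets_generate_pow_ge[of x p] assms(3,4) that by fastforce
    qed
    \<comment> \<open>Here \<open>n < p\<close> ensures \<open>p \<noteq> 0\<close>; a nontrivial
      power of \<open>x\<close> still has infinite order.\<close>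
    show "ord (x [^] p) = 0"
      using assms(3,4) that by (simp add: ord_pow_gen)
  qed (use assms in auto)
  \<comment> \<open>Two consecutive central powers differ by the factor \<open>x\<close>: move each
    past \<open>g\<close>, then cancel \<open>x [^] Suc n\<close>.\<close>
  have "x [^] Suc n \<otimes> (g \<otimes> x) = (x [^] Suc n \<otimes> g) \<otimes> x"
    using assms by (simp add: m_assoc)
  also have "\<dots> = (g \<otimes> x [^] Suc n) \<otimes> x"
    by (simp only: pow_central lessI)
  also have "\<dots> = g \<otimes> x [^] Suc (Suc n)"
    using assms by (simp add: m_assoc)
  also have "\<dots> = x [^] Suc n \<otimes> (x \<otimes> g)"
    using assms pow_central[of "Suc (Suc n)"] by (simp add: m_assoc)
  finally show ?thesis
    using assms by (simp only: l_cancel m_closed nat_pow_closed)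
qed

theorem corollary4p4:
  fixes G :: "('a, 'b) monoid_scheme"
  assumes "group G"
    and "non_periodic_group G"
    and "locally_nilpotent_group G"
    and "BCI_group G"
  shows "comm_group G"
proof -
  interpret group G by fact
  note central = infinite_order_central[OF assms(3,4)]
  obtain z where z: "z \<in> carrier G" "ord z = 0"
    using assms(2) unfolding non_periodic_group_def by blast
  have "g \<otimes>\<^bsub>G\<^esub> y = y \<otimes>\<^bsub>G\<^esub> g" if y: "y \<in> carrier G" and g: "g \<in> carrier G" for y g
  proof (cases "ord y = 0")
    case True
    then show ?thesis using central y g by blast
  next
    case False
    have "ord (y \<otimes>\<^bsub>G\<^esub> z) = 0"
    proof (rule ccontr)
      assume nz: "ord (y \<otimes>\<^bsub>G\<^esub> z) \<noteq> 0"
      \<comment> \<open>A nonzero common multiple of both orders: it kills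
        \<open>y \<otimes> z\<close> and \<open>y\<close>, hence \<open>z\<close>, which has
        infinite order.\<close>
      let ?k = "ord (y \<otimes>\<^bsub>G\<^esub> z) * ord y"
      have "y [^]\<^bsub>G\<^esub> ?k \<otimes>\<^bsub>G\<^esub> z [^]\<^bsub>G\<^esub> ?k = (y \<otimes>\<^bsub>G\<^esub> z) [^]\<^bsub>G\<^esub> ?k"
        using y z central[OF z y] by (intro pow_mult_distrib[symmetric]) simp_all
      also have "\<dots> = \<one>\<^bsub>G\<^esub>"
        using y z by (simp add: pow_eq_id)
      finally have "z [^]\<^bsub>G\<^esub> ?k = \<one>\<^bsub>G\<^esub>"
        using y z pow_eq_id[OF y, of ?k] by simp
      then show False
        using z nz False by (simp add: pow_eq_id)
    qed
    then have "g \<otimes>\<^bsub>G\<^esub> (y \<otimes>\<^bsub>G\<^esub> z) = y \<otimes>\<^bsub>G\<^esub> z \<otimes>\<^bsub>G\<^esub> g"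
      using y z g by (intro central) simp_all
    then have "(g \<otimes>\<^bsub>G\<^esub> y) \<otimes>\<^bsub>G\<^esub> z = (y \<otimes>\<^bsub>G\<^esub> g) \<otimes>\<^bsub>G\<^esub> z"
      using y z g central[OF z g] by (simp add: m_assoc)
    then show ?thesis
      using y z g by (simp add: r_cancel)
  qed
  then show ?thesis
    by (intro group_comm_groupI) auto
qed

end
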